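(* Let $k,\Delta,d\geq 2$ with $\Delta\leq k$. Let $H$ be built by the $2$-step method applied to a connected $(d,\Delta)$-bipartite graph $H_0$ using a $[\Delta,k]$-transversal design $T$. Let $B$ be a block of $H$ and let $B_1,B_2,\ldots,B_\Delta$ be blocks of $H$, not necessarily distinct, but each different from $B$. Then there exist paths in $H$ from $B$ to $B_1$, from $B$ to $B_2$, $\ldots$, from $B$ to $B_\Delta$ such that no edge of $H$ appears in more than one of these paths.
   Context: All bipartite graphs come with a fixed bipartition into a left side, whose vertices are called nodes, and a right side, whose vertices are called blocks. A $(d,\Delta)$-bipartite graph is one in which every node has degree $d$ and every block has degree $\Delta$. A $[\Delta,k]$-transversal design ($k,\Delta\ge2$) is a set of $\Delta k$ elements partitioned into $\Delta$ groups of size $k$, with a family of $k^2$ blocks, each a $\Delta$-subset meeting every group in exactly one element, such that every pair of elements from distinct groups lies in exactly one block; it is viewed as a bipartite graph (elements = nodes, blocks = blocks, adjacency = membership). The $2$-step method: given a connected $(d,\Delta)$-bipartite graph $H_0$, for each node $p$ of $H_0$ introduce a group $G_p$ of $k$ new nodes. For each block $Q$ of $H_0$, with neighbours $p_1,\ldots,p_\Delta$, introduce a copy $T_Q$ of $T$ whose $\Delta$ groups are identified (via bijections) with $G_{p_1},\ldots,G_{p_\Delta}$ and whose $k^2$ blocks are new blocks $B_{Q,U}$ ($U$ ranging over the blocks of $T$), with $B_{Q,U}$ adjacent to the nodes corresponding to the elements of $U$. The resulting bipartite graph $H$ has node set $\bigcup_p G_p$ and block set consisting of all $B_{Q,U}$;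 distinct copies $T_Q$ have disjoint block sets and edge sets. A path is a sequence of distinct vertices with consecutive ones adjacent. *)

theory Defs
  imports Main "HOL-Library.Disjoint_Sets"
begin

text \<open>
  Vertices of a bipartite graph are tagged by their side, \<open>Inl\<close> for nodes and \<open>Inr\<close> for blocks;
  an undirected edge is stored as its (node, block) pair. Graphs are not assumed finite, only
  vertex degrees are.
\<close>

record ('p, 'b) bigraph =
  nodes :: "'p set"
  blocks :: "'b set"
  edges :: "('p \<times> 'b) set"

definition wf_bigraph :: "('p, 'b) bigraph \<Rightarrow> bool" where
  "wf_bigraph H \<longleftrightarrow> edges H \<subseteq> nodes H \<times> blocks H"

definition node_nbrs :: "('p, 'b) bigraph \<Rightarrow> 'p \<Rightarrow> 'b set" where
  "node_nbrs H p = {b. (p, b) \<in> edges H}"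

definition block_nbrs :: "('p, 'b) bigraph \<Rightarrow> 'b \<Rightarrow> 'p set" where
  "block_nbrs H b = {p. (p, b) \<in> edges H}"

definition biregular :: "nat \<Rightarrow> nat \<Rightarrow> ('p, 'b) bigraph \<Rightarrow> bool" where
  "biregular d \<Delta> H \<longleftrightarrow> wf_bigraph H \<and>
     (\<forall>p\<in>nodes H. finite (node_nbrs H p) \<and> card (node_nbrs H p) = d) \<and>
     (\<forall>b\<in>blocks H. finite (block_nbrs H b) \<and> card (block_nbrs H b) = \<Delta>)"

definition vertices :: "('p, 'b) bigraph \<Rightarrow> ('p + 'b) set" where
  "vertices H = Inl ` nodes H \<union> Inr ` blocks H"

definition adjacent :: "('p, 'b) bigraph \<Rightarrow> 'p + 'b \<Rightarrow> 'p + 'b \<Rightarrow> bool" where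
  "adjacent H u v \<longleftrightarrow> (\<exists>p b. (p, b) \<in> edges H \<and> {u, v} = {Inl p, Inr b})"

definition path :: "('p, 'b) bigraph \<Rightarrow> ('p + 'b) list \<Rightarrow> bool" where
  "path H vs \<longleftrightarrow> vs \<noteq> [] \<and> set vs \<subseteq> vertices H \<and> distinct vs \<and> successively (adjacent H) vs"

definition path_between ::
  "('p, 'b) bigraph \<Rightarrow> 'p + 'b \<Rightarrow> ('p + 'b) list \<Rightarrow> 'p + 'b \<Rightarrow> bool" where
  "path_between H u vs v \<longleftrightarrow> path H vs \<and> hd vs = u \<and> last vs = v"

definition path_edges :: "('p + 'b) list \<Rightarrow> ('p \<times> 'b) set" where
  "path_edges vs =
     {(p, b). \<exists>i. Suc i < length vs \<and> {vs ! i, vs ! Suc i} = {Inl p, Inr b}}"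

definition connected_bigraph :: "('p, 'b) bigraph \<Rightarrow> bool" where
  "connected_bigraph H \<longleftrightarrow>
     (\<forall>u\<in>vertices H. \<forall>v\<in>vertices H. \<exists>vs. path_between H u vs v)"

text \<open>
  \<open>X\<close> is the element set, \<open>\<G>\<close> the groups and \<open>\<B>\<close> the blocks. A set of blocks suffices:
  a repeated block would put a pair of elements from distinct groups in two blocks, as \<open>\<Delta> \<ge> 2\<close>.
\<close>

definition transversal_design ::
  "nat \<Rightarrow> nat \<Rightarrow> 'e set \<Rightarrow> 'e set set \<Rightarrow> 'e set set \<Rightarrow> bool" where
  "transversal_design \<Delta> k X \<G> \<B> \<longleftrightarrow>
     2 \<le> k \<and> 2 \<le> \<Delta> \<and>
     card X = \<Delta> * k \<and>
     partition_on X \<G> \<and> card \<G> = \<Delta> \<and> (\<forall>g\<in>\<G>. card g = k) \<and>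
     card \<B> = k\<^sup>2 \<and>
     (\<forall>U\<in>\<B>. U \<subseteq> X \<and> card U = \<Delta> \<and> (\<forall>g\<in>\<G>. card (U \<inter> g) = 1)) \<and>
     (\<forall>g\<in>\<G>. \<forall>h\<in>\<G>. g \<noteq> h \<longrightarrow>
        (\<forall>x\<in>g. \<forall>y\<in>h. \<exists>!U. U \<in> \<B> \<and> x \<in> U \<and> y \<in> U))"

text \<open>
  The choices made in the 2-step method: \<open>G p\<close> is the set of new nodes replacing the node \<open>p\<close>;
  for a block \<open>Q\<close> of \<open>H\<^sub>0\<close>, the group \<open>g\<close> of the design is identified with \<open>G (\<sigma> Q g)\<close>
  via the bijection \<open>\<phi> Q\<close>.
\<close>

definition two_step_choice ::
  "nat \<Rightarrow> ('p, 'q) bigraph \<Rightarrow> 'e set set \<Rightarrow>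
   ('p \<Rightarrow> 'v set) \<Rightarrow> ('q \<Rightarrow> 'e set \<Rightarrow> 'p) \<Rightarrow> ('q \<Rightarrow> 'e \<Rightarrow> 'v) \<Rightarrow> bool" where
  "two_step_choice k H\<^sub>0 \<G> G \<sigma> \<phi> \<longleftrightarrow>
     (\<forall>p\<in>nodes H\<^sub>0. finite (G p) \<and> card (G p) = k) \<and>
     disjoint_family_on G (nodes H\<^sub>0) \<and>
     (\<forall>Q\<in>blocks H\<^sub>0. bij_betw (\<sigma> Q) \<G> (block_nbrs H\<^sub>0 Q) \<and>
        (\<forall>g\<in>\<G>. bij_betw (\<phi> Q) g (G (\<sigma> Q g))))"

text \<open>The new block \<open>B\<^bsub>Q,U\<^esub>\<close> is the pair \<open>(Q, U)\<close>.\<close>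

definition two_step_graph ::
  "('p, 'q) bigraph \<Rightarrow> 'e set set \<Rightarrow> ('p \<Rightarrow> 'v set) \<Rightarrow> ('q \<Rightarrow> 'e \<Rightarrow> 'v) \<Rightarrow>
   ('v, 'q \<times> 'e set) bigraph" where
  "two_step_graph H\<^sub>0 \<B> G \<phi> =
     \<lparr> nodes = (\<Union>p\<in>nodes H\<^sub>0. G p),
       blocks = blocks H\<^sub>0 \<times> \<B>,
       edges = {(v, Q, U). Q \<in> blocks H\<^sub>0 \<and> U \<in> \<B> \<and> v \<in> \<phi> Q ` U} \<rparr>"

end

theory Submission
  imports Defs
begin

text \<open>
  By max-flow min-cut with unit capacities, a source block \<open>B\<close> can be joined to \<open>\<Delta>\<close> prescribed
  targets by edge-disjoint paths as soon as every edge cut separating \<open>B\<close> from some target has at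
  least \<open>\<Delta>\<close> edges. A vertex set separating two blocks of \<open>H\<close> must split some copy \<open>T\<^sub>Q\<close> of the
  design, since \<open>H\<^sub>0\<close> is connected and copies at blocks of \<open>H\<^sub>0\<close> with a common neighbour \<open>p\<close> share
  the nodes \<open>G p\<close>. If all elements of a split copy are on the same side, some block is on the other
  side and its \<open>\<Delta>\<close> edges are cut. Otherwise there is a group all of whose \<open>k \<ge> \<Delta>\<close> elements lie in
  blocks meeting both sides; these blocks are distinct and each of them has a cut edge.
\<close>

subsection \<open>Edge-disjoint paths from a source to prescribed targets\<close>

definition arcs :: "'a list \<Rightarrow> ('a \<times> 'a) set" where
  "arcs vs = set (zip vs (tl vs))"

text \<open>Undirected graphs enter as symmetric arc sets, so that a flow can orient each edge it
  uses.\<close>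

definition dipath :: "('a \<times> 'a) set \<Rightarrow> 'a \<Rightarrow> 'a list \<Rightarrow> 'a \<Rightarrow> bool" where
  "dipath E s vs t \<longleftrightarrow> vs \<noteq> [] \<and> hd vs = s \<and> last vs = t \<and> distinct vs \<and> arcs vs \<subseteq> E"

text \<open>Summing over arcs rather than over vertices keeps the quantity meaningful for infinite
  \<open>S\<close>; only \<open>F\<close> has to be finite.\<close>

definition net_inflow :: "('a \<times> 'a) set \<Rightarrow> 'a set \<Rightarrow> int" where
  "net_inflow F S = (\<Sum>(u, v)\<in>F. of_bool (v \<in> S) - of_bool (u \<in> S))"

lemma arcs_singleton [simp]: "arcs [x] = {}"
  by (simp add: arcs_def)

lemma arcs_Cons: "vs \<noteq> [] \<Longrightarrow> arcs (x # vs) = insert (x, hd vs) (arcs vs)"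
  by (cases vs) (auto simp: arcs_def)

lemma arcs_in_set: "(u, v) \<in> arcs vs \<Longrightarrow> u \<in> set vs \<and> v \<in> set vs"
  unfolding arcs_def by (cases vs) (auto dest: set_zip_leftD set_zip_rightD)

lemma finite_arcs [simp]: "finite (arcs vs)"
  by (simp add: arcs_def)

lemma arcs_append_subset: "arcs vs \<subseteq> arcs (us @ vs)"
proof (induction us)
  case (Cons u us)
  show ?case
  proof (cases "us @ vs = []")
    case False
    then show ?thesis using Cons arcs_Cons[OF False, of u] by auto
  qed (simp add: arcs_def)
qed simp

text \<open>Traversing an edge back would revisit a vertex. A simple path is therefore itself a
  legal flow, using no edge both ways.\<close>

lemma arcs_antisym:
  assumes "distinct vs" "(u, v) \<in> arcs vs"
  shows "(v, u) \<notin> arcs vs"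
  using assms
proof (induction vs)
  case (Cons x vs)
  show ?case
  proof (cases "vs = []")
    case False
    then show ?thesis
      using Cons arcs_in_set[of _ _ vs] hd_in_set[OF False] by (auto simp: arcs_Cons)
  qed (use Cons in simp)
qed (simp add: arcs_def)

lemma dipath_mono: "dipath E s vs t \<Longrightarrow> E \<subseteq> E' \<Longrightarrow> dipath E' s vs t"
  by (auto simp: dipath_def)

text \<open>Arcs are prepended one at a time; if the new first vertex already occurs, the list is
  cut back to that occurrence, which keeps the path simple.\<close>

lemma rtrancl_imp_dipath:
  assumes "(s, t) \<in> E\<^sup>*"
  shows "\<exists>vs. dipath E s vs t"
  using assms
proof (induction rule: converse_rtrancl_induct)
  case base
  have "dipath E t [t] t" by (simp add: dipath_def)
  then show ?case ..
next
  case (step x y)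
  then obtain vs where vs: "dipath E y vs t" by blast
  show ?case
  proof (cases "x \<in> set vs")
    case True
    then obtain us ws where "vs = us @ x # ws" by (meson split_list)
    then have "dipath E x (x # ws) t"
      using vs arcs_append_subset[of "x # ws" us] by (auto simp: dipath_def)
    then show ?thesis ..
  next
    case False
    then have "dipath E x (x # vs) t"
      using vs step.hyps by (auto simp: dipath_def arcs_Cons)
    then show ?thesis ..
  qed
qed

text \<open>The sum telescopes. Distinctness ensures that the set of arcs forgets no repeated
  arc.\<close>

lemma net_inflow_arcs:
  assumes "vs \<noteq> []" "distinct vs"
  shows "net_inflow (arcs vs) S = of_bool (last vs \<in> S) - of_bool (hd vs \<in> S)"
  using assms
proof (induction vs)
  case (Cons x vs)
  show ?case
  proof (cases "vs = []")
    case False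
    have "(x, hd vs) \<notin> arcs vs"
      using Cons.prems arcs_in_set[of x "hd vs" vs] by auto
    then show ?thesis
      using Cons False by (simp add: arcs_Cons net_inflow_def)
  qed (simp add: net_inflow_def)
qed simp

lemma net_inflow_Un_disjoint:
  "finite F \<Longrightarrow> finite F' \<Longrightarrow> F \<inter> F' = {} \<Longrightarrow>
   net_inflow (F \<union> F') S = net_inflow F S + net_inflow F' S"
  by (simp add: net_inflow_def sum.union_disjoint)

lemma net_inflow_Diff:
  "finite F \<Longrightarrow> F' \<subseteq> F \<Longrightarrow> net_inflow (F - F') S = net_inflow F S - net_inflow F' S"
  by (simp add: net_inflow_def sum_diff)

lemma net_inflow_converse: "net_inflow (F\<inverse>) S = - net_inflow F S"
proof -
  have "net_inflow (F\<inverse>) S = (\<Sum>(u, v)\<in>F. of_bool (u \<in> S) - of_bool (v \<in> S))"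
    unfolding net_inflow_def
    by (rule sum.reindex_bij_witness[of _ "\<lambda>(u, v). (v, u)" "\<lambda>(u, v). (v, u)"]) auto
  also have "\<dots> = (\<Sum>a\<in>F. - (case a of (u, v) \<Rightarrow> of_bool (v \<in> S) - of_bool (u \<in> S)))"
    by (rule sum.cong) auto
  finally show ?thesis
    by (simp add: net_inflow_def sum_negf)
qed

text \<open>Where \<open>P\<close> runs against \<open>F\<close>, both arcs are dropped, and their
  contributions were opposite. \<open>P \<inter> F = {}\<close> keeps the two remaining parts
  disjoint.\<close>

lemma net_inflow_augment:
  assumes "finite F" "finite P" "P \<inter> F = {}"
  shows "net_inflow ((F - P\<inverse>) \<union> (P - F\<inverse>)) S = net_inflow F S + net_inflow P S"
proof -
  have "F - P\<inverse> = F - F \<inter> P\<inverse>" "P - F\<inverse> = P - (F \<inter> P\<inverse>)\<inverse>" by auto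
  moreover have "(F - P\<inverse>) \<inter> (P - F\<inverse>) = {}" using assms by auto
  moreover have "net_inflow (P - (F \<inter> P\<inverse>)\<inverse>) S = net_inflow P S + net_inflow (F \<inter> P\<inverse>) S"
    using assms by (subst net_inflow_Diff) (auto simp only: net_inflow_converse)
  ultimately show ?thesis
    using assms by (simp add: net_inflow_Un_disjoint net_inflow_Diff)
qed

text \<open>
  A unit flow sending one unit from \<open>s\<close> to each \<open>t i\<close>. Recording conservation for every vertex set,
  rather than for single vertices, makes all cut computations immediate.
\<close>

definition unit_flow ::
  "('a \<times> 'a) set \<Rightarrow> 'a \<Rightarrow> 'i set \<Rightarrow> ('i \<Rightarrow> 'a) \<Rightarrow> ('a \<times> 'a) set \<Rightarrow> bool" where
  "unit_flow E s I t F \<longleftrightarrow> F \<subseteq> E \<and> finite F \<and> F \<inter> F\<inverse> = {} \<and>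
     (\<forall>S. net_inflow F S = (\<Sum>i\<in>I. of_bool (t i \<in> S) - of_bool (s \<in> S)))"

lemma unit_flow_augment:
  assumes "sym E" "finite I" "j \<notin> I" "unit_flow E s I t F"
    and cut: "\<And>S. s \<in> S \<Longrightarrow> t j \<notin> S \<Longrightarrow> finite (E \<inter> S \<times> -S) \<Longrightarrow> card I < card (E \<inter> S \<times> -S)"
  shows "\<exists>F'. unit_flow E s (insert j I) t F'"
proof -
  from assms(4) have F: "F \<subseteq> E" "finite F" "F \<inter> F\<inverse> = {}"
    "\<And>S. net_inflow F S = (\<Sum>i\<in>I. of_bool (t i \<in> S) - of_bool (s \<in> S))"
    by (auto simp: unit_flow_def)
  \<comment> \<open>\<open>E - F\<close> is the residual graph: \<open>E\<close> is symmetric and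
    \<open>F\<close> uses no edge both ways, so it contains the reversal of every flow arc, and a
    path in it may undo earlier flow.\<close>
  define R where "R = {v. (s, v) \<in> (E - F)\<^sup>*}"
  have "t j \<in> R"
  proof (rule ccontr)
    assume "t j \<notin> R"
    define C where "C = E \<inter> R \<times> -R"
    have sR: "s \<in> R" by (simp add: R_def)
    \<comment> \<open>An arc of \<open>E - F\<close> leaving \<open>R\<close> would extend
      \<open>R\<close>. The blocking cut thus lies in the finite \<open>F\<close>, so a bound on
      finite cuts suffices even in an infinite graph.\<close>
    have CF: "C \<subseteq> F"
      unfolding C_def R_def by (auto intro: rtrancl_into_rtrancl)
    then have "finite C" using F(2) finite_subset by blast
    then have "card I < card C"
      using cut[OF sR \<open>t j \<notin> R\<close>] by (simp add: C_def)
    \<comment> \<open>The reversal of a flow arc entering \<open>R\<close> would be a cut arc, hence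
      in \<open>F\<close> as well.\<close>
    have no_return: "u \<in> R" if "(u, v) \<in> F" "v \<in> R" for u v
    proof (rule ccontr)
      assume "u \<notin> R"
      then have "(v, u) \<in> C"
        using that F(1) \<open>sym E\<close> by (auto simp: C_def dest: symD)
      then show False using CF F(3) that by blast
    qed
    \<comment> \<open>Only the cut arcs contribute, each -1, while the demands give at least -1 per
      index of \<open>I\<close>; so the cut has at most \<open>card I\<close> arcs.\<close>
    have "net_inflow F R = (\<Sum>a\<in>F. if a \<in> C then -1 else 0)"
      unfolding net_inflow_def
      by (rule sum.cong) (use no_return F(1) in \<open>auto simp: C_def of_bool_def split: if_splits\<close>)
    also have "\<dots> = - int (card C)"
      using F(2) CF by (simp add: sum.If_cases Int_absorb1)
    finally have "- int (card C) = (\<Sum>i\<in>I. of_bool (t i \<in> R) - of_bool (s \<in> R))"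
      using F(4) by simp
    also have "\<dots> \<ge> (\<Sum>i\<in>I. -1)"
      using sR by (intro sum_mono) auto
    finally show False
      using \<open>card I < card C\<close> by simp
  qed
  then obtain vs where vs: "dipath (E - F) s vs (t j)"
    using rtrancl_imp_dipath by (fastforce simp: R_def)
  define P where "P = arcs vs"
  have P: "P \<subseteq> E - F" "finite P" "P \<inter> P\<inverse> = {}"
    "\<And>S. net_inflow P S = of_bool (t j \<in> S) - of_bool (s \<in> S)"
    using vs arcs_antisym[of vs] net_inflow_arcs[of vs] by (auto simp: P_def dipath_def)
  have "unit_flow E s (insert j I) t ((F - P\<inverse>) \<union> (P - F\<inverse>))"
    unfolding unit_flow_def
  proof (intro conjI allI)
    fix S
    have "P \<inter> F = {}" using P(1) by auto
    then show "net_inflow ((F - P\<inverse>) \<union> (P - F\<inverse>)) S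
      = (\<Sum>i\<in>insert j I. of_bool (t i \<in> S) - of_bool (s \<in> S))"
      using net_inflow_augment[OF F(2) P(2)] F(4) P(4) assms(2,3) by simp
  qed (use F P in auto)
  then show ?thesis ..
qed

lemma unit_flow_exists:
  assumes "finite I" "sym E"
    and "\<And>i S. i \<in> I \<Longrightarrow> s \<in> S \<Longrightarrow> t i \<notin> S \<Longrightarrow> finite (E \<inter> S \<times> -S) \<Longrightarrow>
           card I \<le> card (E \<inter> S \<times> -S)"
  shows "\<exists>F. unit_flow E s I t F"
proof -
  have "\<exists>F. unit_flow E s J t F" if "finite J" "J \<subseteq> I" for J
    using that
  proof (induction J)
    case empty
    have "unit_flow E s {} t {}" by (simp add: unit_flow_def net_inflow_def)
    then show ?case ..
  next
    case (insert j J)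
    then obtain F where F: "unit_flow E s J t F" by auto
    \<comment> \<open>The bound by \<open>card I\<close> becomes the strict inequality required at
      each augmentation, since \<open>J\<close> still misses \<open>j\<close>.\<close>
    have "card J < card I"
      using insert assms(1) by (intro psubset_card_mono) auto
    then show ?case
      using unit_flow_augment[OF assms(2) \<open>finite J\<close> \<open>j \<notin> J\<close> F] assms(3)[of j] insert.prems
      by (meson insert_subset order_less_le_trans)
  qed
  then show ?thesis using assms(1) by blast
qed

text \<open>Paths are peeled off one target at a time: a simple path to \<open>t j\<close> carries
  exactly the demand of \<open>j\<close>, so what remains is a flow for the other targets. Leftover
  cycles are harmless.\<close>

lemma unit_flow_decompose:
  assumes "finite I" "unit_flow E s I t F"
  shows "\<exists>ps. (\<forall>i\<in>I. dipath F s (ps i) (t i)) \<and>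
              (\<forall>i\<in>I. \<forall>j\<in>I. i \<noteq> j \<longrightarrow> arcs (ps i) \<inter> arcs (ps j) = {})"
  using assms
proof (induction I arbitrary: F)
  case (insert j I)
  from insert.prems have F: "F \<subseteq> E" "finite F" "F \<inter> F\<inverse> = {}"
    "\<And>S. net_inflow F S = (\<Sum>i\<in>insert j I. of_bool (t i \<in> S) - of_bool (s \<in> S))"
    by (auto simp: unit_flow_def)
  define R where "R = {v. (s, v) \<in> F\<^sup>*}"
  have "t j \<in> R"
  proof (rule ccontr)
    assume "t j \<notin> R"
    have sR: "s \<in> R" by (simp add: R_def)
    \<comment> \<open>No flow arc leaves the set reachable in \<open>F\<close>, whereas the unmet
      demand of \<open>j\<close> would force a net inflow of at most -1.\<close>
    have "0 \<le> net_inflow F R"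
      unfolding net_inflow_def R_def
      by (rule sum_nonneg) (auto intro: rtrancl_into_rtrancl)
    also have "net_inflow F R = -1 + (\<Sum>i\<in>I. of_bool (t i \<in> R) - of_bool (s \<in> R))"
      using F(4) insert.hyps \<open>t j \<notin> R\<close> sR by simp
    also have "(\<Sum>i\<in>I. of_bool (t i \<in> R) - of_bool (s \<in> R)) \<le> (0::int)"
      using sR by (intro sum_nonpos) auto
    finally show False by simp
  qed
  then obtain vs where vs: "dipath F s vs (t j)"
    using rtrancl_imp_dipath by (fastforce simp: R_def)
  have "unit_flow E s I t (F - arcs vs)"
    using F vs insert.hyps net_inflow_Diff[OF F(2), of "arcs vs"] net_inflow_arcs[of vs]
    by (auto simp: unit_flow_def dipath_def)
  then obtain ps where ps: "\<forall>i\<in>I. dipath (F - arcs vs) s (ps i) (t i)"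
    "\<forall>i\<in>I. \<forall>j\<in>I. i \<noteq> j \<longrightarrow> arcs (ps i) \<inter> arcs (ps j) = {}"
    using insert.IH by blast
  have "\<forall>i\<in>I. arcs (ps i) \<inter> arcs vs = {}"
    using ps(1) by (auto simp: dipath_def)
  moreover have "\<forall>i\<in>I. dipath F s (ps i) (t i)"
    using ps(1) dipath_mono by (metis Diff_subset)
  ultimately show ?case
    using ps(2) vs insert.hyps by (intro exI[of _ "ps(j := vs)"]) auto
qed simp

text \<open>All paths lie in one flow that uses no edge both ways, so arc-disjointness upgrades to
  disjointness of undirected edges; the converse in the conclusion records this.\<close>

theorem edge_disjoint_paths_to_targets:
  assumes "finite I" "sym E"
    and "\<And>i S. i \<in> I \<Longrightarrow> s \<in> S \<Longrightarrow> t i \<notin> S \<Longrightarrow> finite (E \<inter> S \<times> -S) \<Longrightarrow>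
           card I \<le> card (E \<inter> S \<times> -S)"
  shows "\<exists>ps. (\<forall>i\<in>I. dipath E s (ps i) (t i)) \<and>
              (\<forall>i\<in>I. \<forall>j\<in>I. i \<noteq> j \<longrightarrow> arcs (ps i) \<inter> (arcs (ps j) \<union> (arcs (ps j))\<inverse>) = {})"
proof -
  have "\<exists>F. unit_flow E s I t F"
    by (rule unit_flow_exists) (use assms in auto)
  then obtain F where F: "unit_flow E s I t F" ..
  obtain ps where ps: "\<forall>i\<in>I. dipath F s (ps i) (t i)"
    "\<forall>i\<in>I. \<forall>j\<in>I. i \<noteq> j \<longrightarrow> arcs (ps i) \<inter> arcs (ps j) = {}"
    using unit_flow_decompose[OF assms(1) F] by blast
  have "F \<subseteq> E" "F \<inter> F\<inverse> = {}" using F by (auto simp: unit_flow_def)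
  moreover have "\<forall>i\<in>I. arcs (ps i) \<subseteq> F" using ps(1) by (auto simp: dipath_def)
  ultimately have "\<forall>i\<in>I. dipath E s (ps i) (t i)"
    "\<forall>i\<in>I. \<forall>j\<in>I. arcs (ps i) \<inter> (arcs (ps j))\<inverse> = {}"
    using ps(1) dipath_mono by (metis, blast)
  then show ?thesis using ps(2) by (intro exI[of _ ps]) blast
qed

subsection \<open>Paths in bipartite graphs\<close>

lemma successively_iff_arcs: "successively R vs \<longleftrightarrow> (\<forall>(u, v)\<in>arcs vs. R u v)"
proof (induction vs)
  case (Cons x vs)
  then show ?case by (cases vs) (auto simp: arcs_Cons)
qed (simp add: arcs_def)

lemma path_edges_iff_arcs:
  "(p, b) \<in> path_edges vs \<longleftrightarrow> (Inl p, Inr b) \<in> arcs vs \<or> (Inr b, Inl p) \<in> arcs vs"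
proof -
  have "(u, v) \<in> arcs vs \<longleftrightarrow> (\<exists>i. Suc i < length vs \<and> vs ! i = u \<and> vs ! Suc i = v)" for u v
    unfolding arcs_def set_zip by (auto simp: nth_tl less_diff_conv)
  then show ?thesis
    by (auto simp: path_edges_def doubleton_eq_iff)
qed

lemma dipath_imp_path_between:
  assumes "wf_bigraph H" "s \<in> vertices H" "dipath {(u, v). adjacent H u v} s vs t"
  shows "path_between H s vs t"
proof -
  have "set vs \<subseteq> vertices H" if "vs \<noteq> []" "hd vs \<in> vertices H" "arcs vs \<subseteq> {(u, v). adjacent H u v}" for vs
    using that
  proof (induction vs)
    case (Cons x vs)
    show ?case
    proof (cases "vs = []")
      case False
      then have "adjacent H x (hd vs)" using Cons.prems by (simp add: arcs_Cons)
      then have "hd vs \<in> vertices H"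
        using assms(1) by (auto simp: adjacent_def vertices_def wf_bigraph_def doubleton_eq_iff)
      then show ?thesis using Cons False by (simp add: arcs_Cons)
    qed (use Cons in simp)
  qed simp
  then show ?thesis
    using assms by (auto simp: path_between_def path_def dipath_def successively_iff_arcs)
qed

text \<open>The form in which connectedness is used: a property preserved along edges spreads to the
  whole graph.\<close>

lemma connected_bigraph_invariant:
  assumes "connected_bigraph H" "u \<in> vertices H" "v \<in> vertices H"
    and "\<And>p b. (p, b) \<in> edges H \<Longrightarrow> f (Inl p) = f (Inr b)"
  shows "f u = f v"
proof -
  obtain vs where "path_between H u vs v"
    using assms(1-3) by (auto simp: connected_bigraph_def)
  then have vs: "vs \<noteq> []" "successively (adjacent H) vs" "hd vs = u" "last vs = v"
    by (simp_all add: path_between_def path_def)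
  have "f x = f y" if "adjacent H x y" for x y
    using that assms(4) by (auto simp: adjacent_def doubleton_eq_iff)
  then have "f (hd vs) = f (last vs)" if "vs \<noteq> []" "successively (adjacent H) vs" for vs
    using that by (induction vs) (auto simp: successively_Cons)
  from this[OF vs(1,2)] show ?thesis using vs(3,4) by simp
qed

subsection \<open>Edge cuts of the two-step graph\<close>

text \<open>A block meets a group only once, so such a group supplies a different mixed block for
  each of its elements.\<close>

lemma transversal_design_mixed_group:
  assumes T: "transversal_design \<Delta> k X \<G> \<B>" and "x \<in> X" "x \<in> A" "y \<in> X" "y \<notin> A"
  shows "\<exists>h\<in>\<G>. \<forall>z\<in>h. \<exists>U\<in>\<B>. z \<in> U \<and> U \<inter> A \<noteq> {} \<and> U - A \<noteq> {}"
proof -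
  from T have X: "\<Union>\<G> = X" and "2 \<le> card \<G>"
    and pair: "\<And>g h x y. \<lbrakk>g \<in> \<G>; h \<in> \<G>; g \<noteq> h; x \<in> g; y \<in> h\<rbrakk> \<Longrightarrow> \<exists>U\<in>\<B>. x \<in> U \<and> y \<in> U"
    by (simp_all add: transversal_design_def partition_on_def) metis
  show ?thesis
  proof (cases "\<exists>g\<in>\<G>. \<exists>a\<in>g. \<exists>b\<in>g. a \<in> A \<and> b \<notin> A")
    case True
    then obtain g a b where g: "g \<in> \<G>" "a \<in> g" "b \<in> g" "a \<in> A" "b \<notin> A" by blast
    have "\<not> \<G> \<subseteq> {g}"
      using \<open>2 \<le> card \<G>\<close> card_mono[of "{g}" \<G>] by auto
    then obtain h where h: "h \<in> \<G>" "g \<noteq> h" by blast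
    \<comment> \<open>If \<open>z\<close> is in \<open>A\<close>, the block through \<open>z\<close>
      and \<open>b\<close> is mixed; otherwise the one through \<open>z\<close> and
      \<open>a\<close>.\<close>
    have "\<exists>U\<in>\<B>. z \<in> U \<and> U \<inter> A \<noteq> {} \<and> U - A \<noteq> {}" if "z \<in> h" for z
      using pair[OF g(1) h g(2) that] pair[OF g(1) h g(3) that] g(4,5) by blast
    then show ?thesis using h(1) by blast
  next
    case False
    \<comment> \<open>Every group is now pure: that of \<open>x\<close> lies in \<open>A\<close>,
      that of \<open>y\<close> outside it, so any block joining \<open>x\<close> to the group of
      \<open>y\<close> is mixed.\<close>
    obtain g h where gh: "g \<in> \<G>" "x \<in> g" "h \<in> \<G>" "y \<in> h" using assms X by blast
    with False assms have "g \<noteq> h" by blast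
    have "\<exists>U\<in>\<B>. z \<in> U \<and> U \<inter> A \<noteq> {} \<and> U - A \<noteq> {}" if "z \<in> h" for z
      using pair[OF gh(1,3) \<open>g \<noteq> h\<close> gh(2) that] False gh assms that by blast
    then show ?thesis using gh by blast
  qed
qed

text \<open>Distinct groups go to distinct, hence disjoint, node groups. This makes the edges at a
  block of a copy as numerous as the elements of its design block.\<close>

lemma two_step_inj_on:
  assumes "transversal_design \<Delta> k X \<G> \<B>" "two_step_choice k H\<^sub>0 \<G> G \<sigma> \<phi>"
    and "wf_bigraph H\<^sub>0" "Q \<in> blocks H\<^sub>0"
  shows "inj_on (\<phi> Q) X"
proof (rule inj_onI)
  fix x y assume xy: "x \<in> X" "y \<in> X" and eq: "\<phi> Q x = \<phi> Q y"
  from assms(1) have "\<Union>\<G> = X" by (auto simp: transversal_design_def partition_on_def)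
  with xy obtain g h where gh: "g \<in> \<G>" "x \<in> g" "h \<in> \<G>" "y \<in> h" by blast
  from assms have \<sigma>: "bij_betw (\<sigma> Q) \<G> (block_nbrs H\<^sub>0 Q)"
    and \<phi>: "\<And>g. g \<in> \<G> \<Longrightarrow> bij_betw (\<phi> Q) g (G (\<sigma> Q g))"
    and disj: "disjoint_family_on G (nodes H\<^sub>0)"
    by (auto simp: two_step_choice_def)
  have nodes: "\<sigma> Q g \<in> nodes H\<^sub>0" "\<sigma> Q h \<in> nodes H\<^sub>0"
    using bij_betwE[OF \<sigma>] gh assms(3) by (auto simp: block_nbrs_def wf_bigraph_def)
  have "\<phi> Q x \<in> G (\<sigma> Q g)" "\<phi> Q y \<in> G (\<sigma> Q h)"
    using bij_betwE[OF \<phi>] gh by auto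
  then have "\<sigma> Q g = \<sigma> Q h"
    using disjoint_family_onD[OF disj nodes] eq by auto
  then have "g = h" using \<sigma> gh by (auto simp: bij_betw_def dest: inj_onD)
  then show "x = y" using \<phi>[of g] gh eq by (auto simp: bij_betw_def dest: inj_onD)
qed

lemma two_step_wf:
  assumes "transversal_design \<Delta> k X \<G> \<B>" "two_step_choice k H\<^sub>0 \<G> G \<sigma> \<phi>" "wf_bigraph H\<^sub>0"
  shows "wf_bigraph (two_step_graph H\<^sub>0 \<B> G \<phi>)"
proof -
  have "\<exists>p\<in>nodes H\<^sub>0. \<phi> Q x \<in> G p" if "Q \<in> blocks H\<^sub>0" "U \<in> \<B>" "x \<in> U" for Q U x
  proof -
    have "x \<in> \<Union>\<G>" using assms(1) that by (auto simp: transversal_design_def partition_on_def)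
    then obtain g where g: "g \<in> \<G>" "x \<in> g" by blast
    have "\<phi> Q x \<in> G (\<sigma> Q g)" "\<sigma> Q g \<in> block_nbrs H\<^sub>0 Q"
      using assms(2) that g by (auto simp: two_step_choice_def dest!: bspec dest: bij_betwE)
    then show ?thesis using assms(3) by (auto simp: block_nbrs_def wf_bigraph_def)
  qed
  then show ?thesis by (auto simp: wf_bigraph_def two_step_graph_def)
qed

text \<open>Blocks of different copies are kept apart by the tag \<open>Q\<close>, but nodes may be
  shared; this overlap carries membership in a cut set from copy to copy.\<close>

definition copy_vertices ::
  "('q \<Rightarrow> 'e \<Rightarrow> 'v) \<Rightarrow> 'e set \<Rightarrow> 'e set set \<Rightarrow> 'q \<Rightarrow> ('v + 'q \<times> 'e set) set" where
  "copy_vertices \<phi> X \<B> Q = Inl ` \<phi> Q ` X \<union> Inr ` Pair Q ` \<B>"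

lemma split_copy_cut:
  fixes \<phi> :: "'q \<Rightarrow> 'e \<Rightarrow> 'v"
  assumes T: "transversal_design \<Delta> k X \<G> \<B>" and "\<Delta> \<le> k"
    and Q: "Q \<in> blocks H\<^sub>0" and inj: "inj_on (\<phi> Q) X"
    and E: "E = {(u, v). adjacent (two_step_graph H\<^sub>0 \<B> G \<phi>) u v}"
    and split: "copy_vertices \<phi> X \<B> Q \<inter> S \<noteq> {}" "copy_vertices \<phi> X \<B> Q - S \<noteq> {}"
    and fin: "finite (E \<inter> S \<times> -S)"
  shows "\<Delta> \<le> card (E \<inter> S \<times> -S)"
proof -
  have adj: "(Inl (\<phi> Q x), Inr (Q, U)) \<in> E" "(Inr (Q, U), Inl (\<phi> Q x)) \<in> E"
    if "U \<in> \<B>" "x \<in> U" for x U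
    using that Q by (auto simp: E adjacent_def two_step_graph_def doubleton_eq_iff)
  have UX: "U \<subseteq> X" "card U = \<Delta>" if "U \<in> \<B>" for U
    using T that by (auto simp: transversal_design_def)
  \<comment> \<open>\<open>A\<close> pulls the node part of \<open>S\<close> back to the elements of
    the design.\<close>
  define A where "A = {x. Inl (\<phi> Q x) \<in> S}"
  show ?thesis
  proof (cases "X \<subseteq> A \<or> X \<inter> A = {}")
    case True
    have card_img: "card (\<phi> Q ` U) = \<Delta>" if "U \<in> \<B>" for U
      using that UX inj by (metis card_image inj_on_subset)
    from True show ?thesis
    proof
      assume "X \<subseteq> A"
      then obtain U where U: "U \<in> \<B>" "Inr (Q, U) \<notin> S"
        using split(2) by (auto simp: copy_vertices_def A_def)
      have "(\<lambda>v. (Inl v, Inr (Q, U))) ` (\<phi> Q ` U) \<subseteq> E \<inter> S \<times> -S"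
        using U adj UX(1)[OF U(1)] \<open>X \<subseteq> A\<close> by (auto simp: A_def)
      from card_mono[OF fin this] show ?thesis
        using card_img[OF U(1)] by (simp add: card_image inj_on_def)
    next
      assume "X \<inter> A = {}"
      then obtain U where U: "U \<in> \<B>" "Inr (Q, U) \<in> S"
        using split(1) by (auto simp: copy_vertices_def A_def)
      have "(\<lambda>v. (Inr (Q, U), Inl v)) ` (\<phi> Q ` U) \<subseteq> E \<inter> S \<times> -S"
        using U adj UX(1)[OF U(1)] \<open>X \<inter> A = {}\<close> by (auto simp: A_def)
      from card_mono[OF fin this] show ?thesis
        using card_img[OF U(1)] by (simp add: card_image inj_on_def)
    qed
  next
    case False
    then obtain x y where "x \<in> X" "x \<in> A" "y \<in> X" "y \<notin> A" by blast
    from transversal_design_mixed_group[OF T this]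
    obtain h where h: "h \<in> \<G>" "\<And>z. z \<in> h \<Longrightarrow> \<exists>U\<in>\<B>. z \<in> U \<and> U \<inter> A \<noteq> {} \<and> U - A \<noteq> {}"
      by blast
    \<comment> \<open>\<open>blk\<close> recovers the design block from an arc in either direction.
      As that block meets \<open>h\<close> in one element,
      \<open>the_elem (blk a \<inter> h)\<close> will map the cut arcs onto \<open>h\<close>, which
      has \<open>k\<close> elements.\<close>
    define blk :: "('v + 'q \<times> 'e set) \<times> ('v + 'q \<times> 'e set) \<Rightarrow> 'e set"
      where "blk = (\<lambda>(u, v). case u of Inr c \<Rightarrow> snd c | Inl _ \<Rightarrow> snd (projr v))"
    have "\<exists>a\<in>E \<inter> S \<times> -S. z = the_elem (blk a \<inter> h)" if z: "z \<in> h" for z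
    proof -
      obtain U a b where U: "U \<in> \<B>" "z \<in> U" "a \<in> U" "a \<in> A" "b \<in> U" "b \<notin> A"
        using h(2)[OF z] by blast
      have "card (U \<inter> h) = 1" using T U(1) h(1) by (auto simp: transversal_design_def)
      then have Uh: "U \<inter> h = {z}" using z U(2) by (metis IntI card_1_singletonE singletonD)
      show ?thesis
      proof (cases "Inr (Q, U) \<in> S")
        case True
        then have "(Inr (Q, U), Inl (\<phi> Q b)) \<in> E \<inter> S \<times> -S"
          using adj U by (auto simp: A_def)
        then show ?thesis by (rule bexI[rotated]) (simp add: blk_def Uh)
      next
        case False
        then have "(Inl (\<phi> Q a), Inr (Q, U)) \<in> E \<inter> S \<times> -S"
          using adj U by (auto simp: A_def)
        then show ?thesis by (rule bexI[rotated]) (simp add: blk_def Uh)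
      qed
    qed
    then have "h \<subseteq> (\<lambda>a. the_elem (blk a \<inter> h)) ` (E \<inter> S \<times> -S)" by blast
    from surj_card_le[OF fin this] show ?thesis
      using T h(1) \<open>\<Delta> \<le> k\<close> by (auto simp: transversal_design_def)
  qed
qed

lemma separating_set_splits_copy:
  assumes T: "transversal_design \<Delta> k X \<G> \<B>" and C: "two_step_choice k H\<^sub>0 \<G> G \<sigma> \<phi>"
    and conn: "connected_bigraph H\<^sub>0" and wf: "wf_bigraph H\<^sub>0"
    and B: "Q \<in> blocks H\<^sub>0" "U \<in> \<B>" "Inr (Q, U) \<in> S"
    and B': "Q' \<in> blocks H\<^sub>0" "U' \<in> \<B>" "Inr (Q', U') \<notin> S"
  shows "\<exists>R\<in>blocks H\<^sub>0. copy_vertices \<phi> X \<B> R \<inter> S \<noteq> {} \<and> copy_vertices \<phi> X \<B> R - S \<noteq> {}"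
proof (rule ccontr)
  let ?V = "copy_vertices \<phi> X \<B>"
  assume "\<not> ?thesis"
  then have unsplit: "?V R \<subseteq> S \<or> ?V R \<inter> S = {}" if "R \<in> blocks H\<^sub>0" for R
    using that by blast
  \<comment> \<open>\<open>f\<close> tells whether the part of \<open>H\<close> replacing a vertex
    of \<open>H\<^sub>0\<close> lies in \<open>S\<close>. With no split copy it is constant along
    edges, yet it differs at \<open>Q\<close> and \<open>Q'\<close>.\<close>
  define f where "f = case_sum (\<lambda>p. Inl ` G p \<subseteq> S) (\<lambda>R. ?V R \<subseteq> S)"
  have inv: "f (Inl p) = f (Inr R)" if pR: "(p, R) \<in> edges H\<^sub>0" for p R
  proof -
    have R: "R \<in> blocks H\<^sub>0" "p \<in> block_nbrs H\<^sub>0 R" "p \<in> nodes H\<^sub>0"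
      using pR wf by (auto simp: wf_bigraph_def block_nbrs_def)
    have "\<sigma> R ` \<G> = block_nbrs H\<^sub>0 R"
      using C R(1) by (simp add: two_step_choice_def bij_betw_def)
    with R(2) have "p \<in> \<sigma> R ` \<G>" by simp
    then obtain g where g: "g \<in> \<G>" "\<sigma> R g = p" by (elim imageE) simp
    have "bij_betw (\<phi> R) g (G (\<sigma> R g))"
      using C R(1) g(1) by (simp add: two_step_choice_def)
    then have "G p = \<phi> R ` g" using g(2) by (simp add: bij_betw_def)
    moreover have "g \<subseteq> X" using T g by (auto simp: transversal_design_def partition_on_def)
    ultimately have "Inl ` G p \<subseteq> ?V R" by (auto simp: copy_vertices_def)
    moreover have "card (G p) = k" "2 \<le> k"
      using C T R(3) by (auto simp: two_step_choice_def transversal_design_def)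
    \<comment> \<open>Nonemptiness lets the shared nodes decide the side of the whole copy; for an
      empty group the inclusion in \<open>S\<close> would be vacuous.\<close>
    then have "G p \<noteq> {}" by auto
    ultimately have "Inl ` G p \<subseteq> S \<longleftrightarrow> ?V R \<subseteq> S" using unsplit[OF R(1)] by blast
    then show ?thesis by (simp add: f_def)
  qed
  have "Inr Q \<in> vertices H\<^sub>0" "Inr Q' \<in> vertices H\<^sub>0"
    using B(1) B'(1) by (simp_all add: vertices_def)
  from connected_bigraph_invariant[where f = f, OF conn this inv]
  have "f (Inr Q) = f (Inr Q')" .
  moreover have "Inr (Q, U) \<in> ?V Q" "Inr (Q', U') \<in> ?V Q'"
    using B B' by (auto simp: copy_vertices_def)
  ultimately show False
    using unsplit[OF B(1)] B(3) B'(3) by (auto simp: f_def)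
qed

theorem theorem5:
  fixes k \<Delta> d :: nat
    and H\<^sub>0 :: "('p, 'q) bigraph"
    and X :: "'e set" and \<G> \<B> :: "'e set set"
    and G :: "'p \<Rightarrow> 'v set"
    and \<sigma> :: "'q \<Rightarrow> 'e set \<Rightarrow> 'p"
    and \<phi> :: "'q \<Rightarrow> 'e \<Rightarrow> 'v"
    and H :: "('v, 'q \<times> 'e set) bigraph"
    and B :: "'q \<times> 'e set"
    and Bs :: "nat \<Rightarrow> 'q \<times> 'e set"
  assumes "2 \<le> k" and "2 \<le> \<Delta>" and "2 \<le> d" and "\<Delta> \<le> k"
    and "biregular d \<Delta> H\<^sub>0" and "connected_bigraph H\<^sub>0"
    and "transversal_design \<Delta> k X \<G> \<B>"
    and "two_step_choice k H\<^sub>0 \<G> G \<sigma> \<phi>"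
    and "H = two_step_graph H\<^sub>0 \<B> G \<phi>"
    and "B \<in> blocks H"
    and "\<forall>i\<in>{1..\<Delta>}. Bs i \<in> blocks H \<and> Bs i \<noteq> B"
  shows "\<exists>Ps :: nat \<Rightarrow> ('v + 'q \<times> 'e set) list.
           (\<forall>i\<in>{1..\<Delta>}. path_between H (Inr B) (Ps i) (Inr (Bs i))) \<and>
           (\<forall>i\<in>{1..\<Delta>}. \<forall>j\<in>{1..\<Delta>}. i \<noteq> j \<longrightarrow> path_edges (Ps i) \<inter> path_edges (Ps j) = {})"
proof -
  define E where "E = {(u, v). adjacent H u v}"
  have "sym E" by (auto simp: E_def adjacent_def sym_def insert_commute)
  have wf0: "wf_bigraph H\<^sub>0" using assms(5) by (simp add: biregular_def)
  have wf: "wf_bigraph H" using two_step_wf[OF assms(7,8) wf0] assms(9) by simp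
  have blocks_H: "blocks H = blocks H\<^sub>0 \<times> \<B>" using assms(9) by (simp add: two_step_graph_def)
  have cut: "\<Delta> \<le> card (E \<inter> S \<times> -S)"
    if i: "i \<in> {1..\<Delta>}" and S: "Inr B \<in> S" "Inr (Bs i) \<notin> S" and fin: "finite (E \<inter> S \<times> -S)" for i S
  proof -
    obtain Q U where QU: "B = (Q, U)" "Q \<in> blocks H\<^sub>0" "U \<in> \<B>"
      using assms(10) blocks_H by auto
    obtain Q' U' where QU': "Bs i = (Q', U')" "Q' \<in> blocks H\<^sub>0" "U' \<in> \<B>"
      using assms(11) i blocks_H by (metis SigmaE)
    obtain R where R: "R \<in> blocks H\<^sub>0"
      "copy_vertices \<phi> X \<B> R \<inter> S \<noteq> {}" "copy_vertices \<phi> X \<B> R - S \<noteq> {}"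
      using separating_set_splits_copy[OF assms(7,8,6) wf0 QU(2,3) _ QU'(2,3)] S QU(1) QU'(1)
      by metis
    show ?thesis
      using split_copy_cut[OF assms(7,4) R(1) _ _ R(2,3) fin, of G]
        two_step_inj_on[OF assms(7,8) wf0 R(1)] assms(9) E_def by simp
  qed
  have "\<exists>ps. (\<forall>i\<in>{1..\<Delta>}. dipath E (Inr B) (ps i) (Inr (Bs i))) \<and>
    (\<forall>i\<in>{1..\<Delta>}. \<forall>j\<in>{1..\<Delta>}. i \<noteq> j \<longrightarrow> arcs (ps i) \<inter> (arcs (ps j) \<union> (arcs (ps j))\<inverse>) = {})"
    using cut by (intro edge_disjoint_paths_to_targets \<open>sym E\<close>) auto
  then obtain ps where ps: "\<forall>i\<in>{1..\<Delta>}. dipath E (Inr B) (ps i) (Inr (Bs i))"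
    "\<forall>i\<in>{1..\<Delta>}. \<forall>j\<in>{1..\<Delta>}. i \<noteq> j \<longrightarrow> arcs (ps i) \<inter> (arcs (ps j) \<union> (arcs (ps j))\<inverse>) = {}"
    by blast
  have "Inr B \<in> vertices H" using assms(10) by (simp add: vertices_def)
  then have "\<forall>i\<in>{1..\<Delta>}. path_between H (Inr B) (ps i) (Inr (Bs i))"
    using ps(1) dipath_imp_path_between[OF wf] unfolding E_def by blast
  moreover have "path_edges (ps i) \<inter> path_edges (ps j) = {}"
    if "i \<in> {1..\<Delta>}" "j \<in> {1..\<Delta>}" "i \<noteq> j" for i j
  proof -
    \<comment> \<open>The converse excludes an edge that two paths traverse in opposite
      directions.\<close>
    have "arcs (ps i) \<inter> (arcs (ps j) \<union> (arcs (ps j))\<inverse>) = {}" using ps(2) that by blast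
    then show ?thesis by (auto simp: path_edges_iff_arcs)
  qed
  ultimately show ?thesis by blast
qed

end
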